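(* Let $g$ be a multiplicative function on squarefree integers with $0\leqslant g(p)<1$ for every prime $p$, and let $h$ be the multiplicative function on squarefree integers with $h(p)=g(p)/(1-g(p))$. Let $z>w\geqslant 2$ and $\Delta\geqslant w^3$, and put $\alpha=\log w/\log\Delta$. All sums over $d$ below run over squarefree positive integers, and $p$ denotes primes. Define $$H=\sum_{d\leqslant\Delta}h(d)\log\frac{\Delta}{d},\qquad y_d=\begin{cases}H^{-1}\log(\Delta/d) & d\leqslant\Delta,\\ 0 & d>\Delta,\end{cases}$$ $$W=\sum_d h(d)y_d^2-\sum_{p<z}g(p)\sum_{(d,p)=1}h(d)\,(y_d-y_{pd})^2,\qquad J=\sum_{d\leqslant\Delta}h(d).$$ Assume that (i) $G(w):=\sum_{p\leqslant w}g(p)(\log p)^2\leqslant\tfrac32(\log w)^2$, and (ii) $J(w,\Delta)(\log\Delta)^2\leqslant 3K(w^2,\Delta)$, where $J(w,\Delta)=\sum_{w<d\leqslant\Delta}h(d)$ and $K(w^2,\Delta)=\sum_{w^2<d\leqslant\Delta}h(d)(\log\Delta/d)^2$. Let $$\nu=1-\sum_{w<p\leqslant z}g(p)-\tfrac92\alpha^2.$$ If $\nu>0$, then $JW\geqslant\nu$.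
   Context: $W$ is the main-term quadratic form of Selberg's lower-bound sieve written in the variables $y_d$ (supported on squarefree $d\leqslant\Delta$, normalized by $\sum_d h(d)y_d=1$). *)

theory Defs
  imports Complex_Main "HOL-Computational_Algebra.Primes"
    "HOL-Computational_Algebra.Squarefree" "HOL-Analysis.Infinite_Sum"
begin

text \<open>Only the values at squarefree arguments are constrained.\<close>

definition multiplicative_on_squarefree :: "(nat \<Rightarrow> real) \<Rightarrow> bool" where
  "multiplicative_on_squarefree f \<longleftrightarrow>
     f 1 = 1 \<and>
     (\<forall>m n. squarefree m \<longrightarrow> squarefree n \<longrightarrow> coprime m n \<longrightarrow> f (m * n) = f m * f n)"

definition selberg_H :: "(nat \<Rightarrow> real) \<Rightarrow> real \<Rightarrow> real" where
  "selberg_H h \<Delta> = (\<Sum>d | squarefree d \<and> real d \<le> \<Delta>. h d * ln (\<Delta> / real d))"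

definition selberg_y :: "(nat \<Rightarrow> real) \<Rightarrow> real \<Rightarrow> nat \<Rightarrow> real" where
  "selberg_y h \<Delta> d = (if real d \<le> \<Delta> then inverse (selberg_H h \<Delta>) * ln (\<Delta> / real d) else 0)"

text \<open>The sums over \<open>d\<close> are unrestricted in size; since \<open>y\<close> vanishes beyond \<open>\<Delta>\<close>, only finitely
  many terms are nonzero, so these infinite sums raise no convergence issue.\<close>

definition selberg_W :: "(nat \<Rightarrow> real) \<Rightarrow> (nat \<Rightarrow> real) \<Rightarrow> real \<Rightarrow> real \<Rightarrow> real" where
  "selberg_W g h z \<Delta> =
     (\<Sum>\<^sub>\<infinity>d\<in>{d. squarefree d}. h d * (selberg_y h \<Delta> d)\<^sup>2)
     - (\<Sum>p | prime p \<and> real p < z.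
          g p * (\<Sum>\<^sub>\<infinity>d\<in>{d. squarefree d \<and> coprime d p}.
                   h d * (selberg_y h \<Delta> d - selberg_y h \<Delta> (p * d))\<^sup>2))"

definition selberg_J :: "(nat \<Rightarrow> real) \<Rightarrow> real \<Rightarrow> real" where
  "selberg_J h \<Delta> = (\<Sum>d | squarefree d \<and> real d \<le> \<Delta>. h d)"

definition selberg_J_between :: "(nat \<Rightarrow> real) \<Rightarrow> real \<Rightarrow> real \<Rightarrow> real" where
  "selberg_J_between h u \<Delta> = (\<Sum>d | squarefree d \<and> u < real d \<and> real d \<le> \<Delta>. h d)"

definition selberg_K_between :: "(nat \<Rightarrow> real) \<Rightarrow> real \<Rightarrow> real \<Rightarrow> real" where
  "selberg_K_between h u \<Delta> =
     (\<Sum>d | squarefree d \<and> u < real d \<and> real d \<le> \<Delta>. h d * (ln (\<Delta> / real d))\<^sup>2)"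

definition selberg_G :: "(nat \<Rightarrow> real) \<Rightarrow> real \<Rightarrow> real" where
  "selberg_G g w = (\<Sum>p | prime p \<and> real p \<le> w. g p * (ln (real p))\<^sup>2)"

end

theory Submission
  imports Defs "HOL-Analysis.Convex"
begin

text \<open>Write \<open>\<ell>(d) = log\<^sup>+ (\<Delta>/d)\<close>, so that \<open>y = \<ell>/H\<close>, and \<open>K = \<Sum> h(d) \<ell>(d)\<^sup>2\<close>. For \<open>p > w\<close> one uses
  \<open>\<ell>(d) - \<ell>(pd) \<le> \<ell>(d)\<close>, and for \<open>p \<le> w\<close> one uses \<open>\<ell>(d) - \<ell>(pd) \<le> log p\<close>; the latter primes
  contribute at most \<open>G(w) J\<close>. Hypothesis (ii) extends to \<open>J (log \<Delta>)\<^sup>2 \<le> 3 K\<close>, because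
  \<open>\<ell>(d) \<ge> (2/3) log \<Delta>\<close> for \<open>d \<le> w\<close>. Hence \<open>H\<^sup>2 W \<ge> \<nu> K\<close>, and \<open>H\<^sup>2 \<le> J K\<close> by Cauchy--Schwarz.\<close>

text \<open>Any prime factor \<open>p\<close> can be split off: if it divided the cofactor as well,
  \<open>p\<^sup>2\<close> would divide \<open>n\<close>. This carries the sign of a multiplicative
  function from primes to all squarefree integers, and so yields nonnegative weights
  \<open>h d\<close>.\<close>

lemma squarefree_prime_induct [consumes 1, case_names one mult]:
  fixes n :: nat
  assumes "squarefree n" and "P 1"
    and step: "\<And>p m. prime p \<Longrightarrow> squarefree m \<Longrightarrow> coprime p m \<Longrightarrow> P m \<Longrightarrow> P (p * m)"
  shows "P n"
  using \<open>squarefree n\<close>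
proof (induction n rule: less_induct)
  case (less n)
  show ?case
  proof (cases "n = 1")
    case False
    then obtain p where p: "prime p" "p dvd n"
      using prime_factor_nat by blast
    then obtain m where n: "n = p * m" by blast
    have "n > 0" using less.prems by (cases n) auto
    have sf: "squarefree m" using less.prems n squarefree_multD by blast
    have "coprime p m"
    proof (rule ccontr)
      assume "\<not> coprime p m"
      then have "p dvd m" using p(1) prime_imp_coprime by blast
      then have "p\<^sup>2 dvd n" by (simp add: n power2_eq_square)
      then have "is_unit p" using less.prems squarefreeD by blast
      with p(1) show False by simp
    qed
    moreover have "m < n" using n p(1) \<open>n > 0\<close> prime_gt_1_nat[of p] by simp
    ultimately show ?thesis using less.IH sf step p(1) n by blast
  qed (use assms(2) in simp)
qed

lemma multiplicative_on_squarefree_nonneg: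
  assumes "multiplicative_on_squarefree f" and "\<And>p. prime p \<Longrightarrow> f p \<ge> 0" and "squarefree n"
  shows "f n \<ge> 0"
  using assms(3)
proof (induction rule: squarefree_prime_induct)
  case one
  then show ?case using assms(1) by (simp add: multiplicative_on_squarefree_def)
next
  case (mult p m)
  then have "f (p * m) = f p * f m"
    using assms(1) squarefree_prime[of p] by (simp add: multiplicative_on_squarefree_def)
  then show ?case using mult assms(2) by simp
qed

text \<open>The unweighted inequality applied to \<open>sqrt (a i)\<close> and
  \<open>sqrt (a i) * x i\<close>; nonnegative weights are what makes the square roots multiply back
  to \<open>a i\<close>.\<close>

lemma weighted_Cauchy_Schwarz_sum:
  fixes a x :: "'a \<Rightarrow> real"
  assumes "\<And>i. i \<in> A \<Longrightarrow> a i \<ge> 0"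
  shows "(\<Sum>i\<in>A. a i * x i)\<^sup>2 \<le> (\<Sum>i\<in>A. a i) * (\<Sum>i\<in>A. a i * (x i)\<^sup>2)"
proof -
  have "(\<Sum>i\<in>A. a i * x i) = (\<Sum>i\<in>A. sqrt (a i) * (sqrt (a i) * x i))"
    using assms by (intro sum.cong) (auto simp flip: mult.assoc)
  moreover have "(\<Sum>i\<in>A. (sqrt (a i))\<^sup>2) = (\<Sum>i\<in>A. a i)"
    "(\<Sum>i\<in>A. (sqrt (a i) * x i)\<^sup>2) = (\<Sum>i\<in>A. a i * (x i)\<^sup>2)"
    using assms by (auto intro!: sum.cong simp: power_mult_distrib)
  ultimately show ?thesis
    using Cauchy_Schwarz_ineq_sum[of "\<lambda>i. sqrt (a i)" "\<lambda>i. sqrt (a i) * x i" A] by simp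
qed

lemma finite_nat_real_le: "finite {n :: nat. P n \<and> real n \<le> x}"
  by (rule finite_subset[of _ "{..nat \<lfloor>x\<rfloor>}"]) (auto simp: le_nat_floor)

definition trunc_log :: "real \<Rightarrow> nat \<Rightarrow> real" where
  "trunc_log \<Delta> d = (if real d \<le> \<Delta> then ln (\<Delta> / real d) else 0)"

lemma selberg_y_eq_trunc_log: "selberg_y h \<Delta> d = inverse (selberg_H h \<Delta>) * trunc_log \<Delta> d"
  by (simp add: selberg_y_def trunc_log_def)

lemma trunc_log_nonneg: "d > 0 \<Longrightarrow> trunc_log \<Delta> d \<ge> 0"
  by (simp add: trunc_log_def)

lemma trunc_log_mult_le:
  assumes "d > 0" "p > 0"
  shows "trunc_log \<Delta> (p * d) \<le> trunc_log \<Delta> d"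
proof (cases "real (p * d) \<le> \<Delta>")
  case True
  have "real d \<le> real (p * d)" using assms by simp
  with True have "real d \<le> \<Delta>" by linarith
  with True assms show ?thesis by (auto simp: trunc_log_def ln_div ln_mult)
qed (use assms trunc_log_nonneg[of d \<Delta>] in \<open>simp add: trunc_log_def\<close>)

text \<open>Equality holds while \<open>p * d\<close> stays below the cutoff. If only
  \<open>d\<close> does, then \<Delta> / d < p bounds the one remaining logarithm; beyond the cutoff
  both terms vanish.\<close>

lemma trunc_log_diff_le_ln:
  assumes "d > 0" "p > 0"
  shows "trunc_log \<Delta> d - trunc_log \<Delta> (p * d) \<le> ln (real p)"
proof (cases "real (p * d) \<le> \<Delta>")
  case True
  have "real d \<le> real (p * d)" using assms by simp
  with True have "real d \<le> \<Delta>" by linarith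
  with True assms show ?thesis by (simp add: trunc_log_def ln_div ln_mult)
next
  case False
  show ?thesis
  proof (cases "real d \<le> \<Delta>")
    case True
    then have "\<Delta> > 0" using assms by (smt (verit) of_nat_0_less_iff)
    then have "ln (\<Delta> / real d) \<le> ln (real p)"
      using False assms by (simp add: divide_le_eq)
    with True False show ?thesis by (simp add: trunc_log_def)
  qed (use False assms in \<open>simp add: trunc_log_def\<close>)
qed

text \<open>Reduces the infinite sums in \<open>selberg_W\<close> to finite ones, where no
  summability has to be discussed.\<close>

lemma infsum_eq_sum_truncated:
  fixes F :: "nat \<Rightarrow> real"
  assumes "\<And>d. P d \<Longrightarrow> \<not> real d \<le> \<Delta> \<Longrightarrow> F d = 0"
  shows "(\<Sum>\<^sub>\<infinity>d\<in>{d. P d}. F d) = (\<Sum>d | P d \<and> real d \<le> \<Delta>. F d)"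
proof -
  have "(\<Sum>\<^sub>\<infinity>d\<in>{d. P d}. F d) = (\<Sum>\<^sub>\<infinity>d\<in>{d. P d \<and> real d \<le> \<Delta>}. F d)"
    by (rule infsum_cong_neutral) (use assms in auto)
  then show ?thesis by (simp add: finite_nat_real_le)
qed

theorem theorem3p1:
  fixes g h :: "nat \<Rightarrow> real" and z w \<Delta> \<alpha> \<nu> :: real
  assumes "multiplicative_on_squarefree g"
    and "\<And>p. prime p \<Longrightarrow> 0 \<le> g p \<and> g p < 1"
    and "multiplicative_on_squarefree h"
    and "\<And>p. prime p \<Longrightarrow> h p = g p / (1 - g p)"
    and "z > w" and "w \<ge> 2" and "\<Delta> \<ge> w ^ 3"
    and "\<alpha> = ln w / ln \<Delta>"
    and "selberg_G g w \<le> 3 / 2 * (ln w)\<^sup>2"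
    and "selberg_J_between h w \<Delta> * (ln \<Delta>)\<^sup>2 \<le> 3 * selberg_K_between h (w\<^sup>2) \<Delta>"
    and "\<nu> = 1 - (\<Sum>p | prime p \<and> w < real p \<and> real p \<le> z. g p) - 9 / 2 * \<alpha>\<^sup>2"
    and "\<nu> > 0"
  shows "selberg_J h \<Delta> * selberg_W g h z \<Delta> \<ge> \<nu>"
proof -
  define D where "D = {d :: nat. squarefree d \<and> real d \<le> \<Delta>}"
  define l where "l = trunc_log \<Delta>"
  define J where "J = selberg_J h \<Delta>"
  define H where "H = selberg_H h \<Delta>"
  \<comment> \<open>Up to the factor \<open>H\<^sup>2\<close>, \<open>K\<close> is the first sum in
    W and \<open>B p\<close> is the inner sum belonging to the prime \<open>p\<close>.\<close>
  define K where "K = (\<Sum>d\<in>D. h d * (l d)\<^sup>2)"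
  define B where "B p = (\<Sum>d | (squarefree d \<and> coprime d p) \<and> real d \<le> \<Delta>.
    h d * (l d - l (p * d))\<^sup>2)" for p
  have finD: "finite D" unfolding D_def by (rule finite_nat_real_le)
  have pos: "d > 0" if "squarefree d" for d :: nat
    using that by (cases d) auto
  have hnn: "h d \<ge> 0" if "squarefree d" for d
    using multiplicative_on_squarefree_nonneg[OF assms(3) _ that] assms(2,4)
    by (simp add: less_imp_le)
  have "w ^ 3 \<ge> 2 ^ 3" using assms(6) by (intro power_mono) auto
  with assms(7) have \<Delta>8: "\<Delta> \<ge> 8" by simp
  have lnw: "ln w > 0" using assms(6) by simp
  have ln\<Delta>: "ln \<Delta> > 0" using \<Delta>8 by simp
  \<comment> \<open>The exponent 3 enters only here: an integer d \<le> w satisfies ln d \<le> (1/3)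
    ln \<Delta>.\<close>
  have "ln (w ^ 3) \<le> ln \<Delta>" using assms(6,7) \<Delta>8 by simp
  then have ln3: "3 * ln w \<le> ln \<Delta>" using assms(6) by (simp add: ln_realpow)

  have J_eq: "J = (\<Sum>d\<in>D. h d)" by (simp add: J_def selberg_J_def D_def)
  have H_eq: "H = (\<Sum>d\<in>D. h d * l d)"
    by (auto simp: H_def selberg_H_def D_def l_def trunc_log_def intro!: sum.cong)
  have Jnn: "J \<ge> 0" unfolding J_eq by (intro sum_nonneg) (auto simp: D_def hnn)
  have lnn: "l d \<ge> 0" if "d \<in> D" for d
    using that pos trunc_log_nonneg by (auto simp: D_def l_def)
  \<comment> \<open>The term d = 1 alone equals ln \<Delta> > 0, and the other terms are
    nonnegative. Thus \<open>inverse H\<close> is a genuine reciprocal, not the default value at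
    0.\<close>
  have "h 1 * l 1 \<le> H"
    unfolding H_eq by (rule member_le_sum) (use \<Delta>8 finD lnn hnn in \<open>auto simp: D_def\<close>)
  moreover have "h 1 = 1" using assms(3) by (simp add: multiplicative_on_squarefree_def)
  moreover have "l 1 = ln \<Delta>" using \<Delta>8 by (simp add: l_def trunc_log_def)
  ultimately have Hpos: "H > 0" using ln\<Delta> by simp

  have W_eq: "selberg_W g h z \<Delta> = (inverse H)\<^sup>2 * (K - (\<Sum>p | prime p \<and> real p < z. g p * B p))"
  proof -
    have 1: "(\<Sum>\<^sub>\<infinity>d\<in>{d. squarefree d}. h d * (selberg_y h \<Delta> d)\<^sup>2) = (inverse H)\<^sup>2 * K"
      by (subst infsum_eq_sum_truncated[where \<Delta> = \<Delta>])
        (auto simp: selberg_y_def K_def H_def D_def l_def trunc_log_def sum_distrib_left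
          power_mult_distrib algebra_simps intro!: sum.cong)
    have 2: "(\<Sum>\<^sub>\<infinity>d\<in>{d. squarefree d \<and> coprime d p}. h d * (selberg_y h \<Delta> d - selberg_y h \<Delta> (p * d))\<^sup>2)
        = (inverse H)\<^sup>2 * B p" if "prime p" for p
    proof -
      have "h d * (selberg_y h \<Delta> d - selberg_y h \<Delta> (p * d))\<^sup>2
          = (inverse H)\<^sup>2 * (h d * (l d - l (p * d))\<^sup>2)" for d
        by (simp add: selberg_y_eq_trunc_log H_def l_def power_mult_distrib
            flip: right_diff_distrib)
      \<comment> \<open>Multiplying by \<open>p\<close> cannot bring \<open>d\<close> back below
        \<Delta>, so the differences are cut off at \<Delta> as well.\<close>
      moreover have "l d - l (p * d) = 0" if "\<not> real d \<le> \<Delta>" for d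
      proof -
        have "real d \<le> real p * real d" using prime_gt_0_nat[OF \<open>prime p\<close>] by (cases d) auto
        with that show ?thesis by (simp add: l_def trunc_log_def)
      qed
      ultimately show ?thesis
        by (simp only: B_def sum_distrib_left) (rule infsum_eq_sum_truncated, simp)
    qed
    have "(\<Sum>p | prime p \<and> real p < z. g p *
        (\<Sum>\<^sub>\<infinity>d\<in>{d. squarefree d \<and> coprime d p}. h d * (selberg_y h \<Delta> d - selberg_y h \<Delta> (p * d))\<^sup>2))
        = (inverse H)\<^sup>2 * (\<Sum>p | prime p \<and> real p < z. g p * B p)"
      unfolding sum_distrib_left by (intro sum.cong) (auto simp: 2)
    then show ?thesis unfolding selberg_W_def 1 by (simp add: algebra_simps)
  qed

  \<comment> \<open>The bound \<open>c\<close> will be \<open>l\<close> for p > w and the constant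
    \<open>ln p\<close> for p \<le> w. Squaring it is legitimate because the difference is
    nonnegative; dropping the coprimality condition only adds nonnegative terms.\<close>
  have B_le: "B p \<le> (\<Sum>d\<in>D. h d * (c d)\<^sup>2)"
    if "prime p" "\<And>d. d \<in> D \<Longrightarrow> l d - l (p * d) \<le> c d" for p c
  proof -
    have "(l d - l (p * d))\<^sup>2 \<le> (c d)\<^sup>2" if "d \<in> D" for d
      using trunc_log_mult_le[of d p \<Delta>] pos[of d] prime_gt_0_nat[OF \<open>prime p\<close>] that
        \<open>d \<in> D \<Longrightarrow> l d - l (p * d) \<le> c d\<close>
      by (intro power_mono) (auto simp: D_def l_def)
    then have "B p \<le> (\<Sum>d | (squarefree d \<and> coprime d p) \<and> real d \<le> \<Delta>. h d * (c d)\<^sup>2)"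
      unfolding B_def by (intro sum_mono mult_left_mono) (auto simp: D_def hnn)
    also have "\<dots> \<le> (\<Sum>d\<in>D. h d * (c d)\<^sup>2)"
      by (intro sum_mono2 finD) (auto simp: D_def hnn)
    finally show ?thesis .
  qed
  have B_le_K: "B p \<le> K" if "prime p" for p
    unfolding K_def using that pos trunc_log_nonneg prime_gt_0_nat
    by (intro B_le) (auto simp: D_def l_def)
  have B_le_J: "B p \<le> (ln (real p))\<^sup>2 * J" if "prime p" for p
  proof -
    have "B p \<le> (\<Sum>d\<in>D. h d * (ln (real p))\<^sup>2)"
      using that pos trunc_log_diff_le_ln prime_gt_0_nat
      by (intro B_le) (auto simp: D_def l_def)
    then show ?thesis by (simp add: J_eq mult.commute flip: sum_distrib_right)
  qed
  have Bnn: "B p \<ge> 0" for p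
    unfolding B_def by (intro sum_nonneg) (auto simp: hnn)

  have JK: "J * (ln \<Delta>)\<^sup>2 \<le> 3 * K"
  proof -
    define D1 where "D1 = {d \<in> D. real d \<le> w}"
    define D2 where "D2 = {d \<in> D. w < real d}"
    define D3 where "D3 = {d \<in> D. w\<^sup>2 < real d}"
    \<comment> \<open>\<open>D1\<close> and \<open>D2\<close> partition \<open>D\<close>, whereas
      \<open>D1\<close> and \<open>D3\<close> need only be disjoint, which this inequality ensures.
      The range w < d \<le> \<open>w\<^sup>2\<close> is discarded from \<open>K\<close>.\<close>
    have w_sq: "w \<le> w\<^sup>2" using assms(6) by (simp add: power2_eq_square)
    have "h d * (ln \<Delta>)\<^sup>2 \<le> 3 * (h d * (l d)\<^sup>2)" if "d \<in> D1" for d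
    proof -
      have d: "squarefree d" "real d \<le> \<Delta>" "real d \<le> w" "d > 0"
        using that pos by (auto simp: D1_def D_def)
      then have "l d = ln \<Delta> - ln (real d)"
        using \<Delta>8 by (simp add: l_def trunc_log_def ln_div)
      moreover have "ln (real d) \<le> ln w" using d by simp
      ultimately have "2 / 3 * ln \<Delta> \<le> l d" using ln3 by simp
      then have "(2 / 3 * ln \<Delta>)\<^sup>2 \<le> (l d)\<^sup>2" using ln\<Delta> by (intro power_mono) auto
      then have "4 / 9 * (ln \<Delta>)\<^sup>2 \<le> (l d)\<^sup>2" by (simp add: power2_eq_square)
      \<comment> \<open>There is room to spare: 3 * 4/9 = 4/3, while 1 would suffice.\<close>
      then have "(ln \<Delta>)\<^sup>2 \<le> 3 * (l d)\<^sup>2" using zero_le_power2[of "ln \<Delta>"] by linarith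
      then have "h d * (ln \<Delta>)\<^sup>2 \<le> h d * (3 * (l d)\<^sup>2)" using hnn d by (intro mult_left_mono) auto
      then show ?thesis by simp
    qed
    then have "(\<Sum>d\<in>D1. h d) * (ln \<Delta>)\<^sup>2 \<le> 3 * (\<Sum>d\<in>D1. h d * (l d)\<^sup>2)"
      unfolding sum_distrib_left sum_distrib_right by (rule sum_mono)
    moreover have "(\<Sum>d\<in>D2. h d) * (ln \<Delta>)\<^sup>2 \<le> 3 * (\<Sum>d\<in>D3. h d * (l d)\<^sup>2)"
    proof -
      have "selberg_J_between h w \<Delta> = (\<Sum>d\<in>D2. h d)"
        by (auto simp: selberg_J_between_def D2_def D_def intro!: sum.cong)
      moreover have "selberg_K_between h (w\<^sup>2) \<Delta> = (\<Sum>d\<in>D3. h d * (l d)\<^sup>2)"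
        by (auto simp: selberg_K_between_def D3_def D_def l_def trunc_log_def intro!: sum.cong)
      ultimately show ?thesis using assms(10) by simp
    qed
    moreover have J_split: "J = (\<Sum>d\<in>D1. h d) + (\<Sum>d\<in>D2. h d)"
      unfolding J_eq using finD
      by (subst sum.union_disjoint[symmetric]) (auto simp: D1_def D2_def intro!: sum.cong)
    moreover have "(\<Sum>d\<in>D1. h d * (l d)\<^sup>2) + (\<Sum>d\<in>D3. h d * (l d)\<^sup>2) \<le> K"
    proof -
      have "(\<Sum>d\<in>D1. h d * (l d)\<^sup>2) + (\<Sum>d\<in>D3. h d * (l d)\<^sup>2) = (\<Sum>d\<in>D1 \<union> D3. h d * (l d)\<^sup>2)"
        using finD w_sq by (intro sum.union_disjoint[symmetric]) (auto simp: D1_def D3_def)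
      also have "\<dots> \<le> K"
        unfolding K_def using finD by (intro sum_mono2) (auto simp: D1_def D3_def D_def hnn)
      finally show ?thesis .
    qed
    ultimately show ?thesis unfolding J_split distrib_right by linarith
  qed

  define S where "S = (\<Sum>p | prime p \<and> w < real p \<and> real p \<le> z. g p)"
  have "(\<Sum>p | prime p \<and> real p < z. g p * B p) \<le> (S + 9 / 2 * \<alpha>\<^sup>2) * K"
  proof -
    have fin: "finite {p. prime p \<and> real p \<le> w}" "finite {p. prime p \<and> w < real p \<and> real p \<le> z}"
      using finite_nat_real_le[of prime w] finite_nat_real_le[of "\<lambda>p. prime p \<and> w < real p" z]
      by (simp_all add: conj_assoc)
    \<comment> \<open>Since w < z, the union consists of the primes p \<le> z. At most the
      nonnegative term at p = z is added, which matches the closed range of summation in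
      \<nu>.\<close>
    have "(\<Sum>p | prime p \<and> real p < z. g p * B p)
        \<le> (\<Sum>p\<in>{p. prime p \<and> real p \<le> w} \<union> {p. prime p \<and> w < real p \<and> real p \<le> z}. g p * B p)"
      using fin assms(2) Bnn by (intro sum_mono2) auto
    also have "\<dots> = (\<Sum>p | prime p \<and> real p \<le> w. g p * B p)
        + (\<Sum>p | prime p \<and> w < real p \<and> real p \<le> z. g p * B p)"
      using fin by (intro sum.union_disjoint) auto
    also have "(\<Sum>p | prime p \<and> w < real p \<and> real p \<le> z. g p * B p) \<le> S * K"
      unfolding S_def sum_distrib_right
      using assms(2) B_le_K by (intro sum_mono mult_left_mono) auto
    also have "(\<Sum>p | prime p \<and> real p \<le> w. g p * B p) \<le> selberg_G g w * J"
      unfolding selberg_G_def sum_distrib_right mult.assoc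
      using assms(2) B_le_J by (intro sum_mono mult_left_mono) auto
    also have "selberg_G g w * J \<le> 3 / 2 * (ln w)\<^sup>2 * J"
      using assms(9) Jnn by (intro mult_right_mono)
    \<comment> \<open>Substituting ln w = \<alpha> ln \<Delta> prepares the use of
      \<open>JK\<close>; the product of 3/2 and 3 is the constant 9/2 in \<nu>.\<close>
    also have "\<dots> = 3 / 2 * \<alpha>\<^sup>2 * (J * (ln \<Delta>)\<^sup>2)"
      using ln\<Delta> by (simp add: assms(8) power_divide)
    also have "\<dots> \<le> 3 / 2 * \<alpha>\<^sup>2 * (3 * K)"
      using JK by (intro mult_left_mono) auto
    finally show ?thesis by (simp add: algebra_simps)
  qed
  then have "\<nu> * K \<le> K - (\<Sum>p | prime p \<and> real p < z. g p * B p)"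
    by (simp add: assms(11) S_def algebra_simps)
  then have "J * ((inverse H)\<^sup>2 * (\<nu> * K)) \<le> J * selberg_W g h z \<Delta>"
    unfolding W_eq using Jnn by (intro mult_left_mono) auto
  moreover have "H\<^sup>2 \<le> J * K"
    unfolding H_eq J_eq K_def by (intro weighted_Cauchy_Schwarz_sum) (auto simp: D_def hnn)
  \<comment> \<open>Positivity of \<nu> preserves the direction of J K / \<open>H\<^sup>2\<close>
    \<ge> 1 under multiplication; the unknown size of \<open>K\<close> thereby drops out.\<close>
  then have "\<nu> * 1 \<le> \<nu> * (J * K / H\<^sup>2)"
    using Hpos assms(12) by (intro mult_left_mono) auto
  ultimately show ?thesis by (simp add: J_def field_simps)
qed

end
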